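(* Let $T>0$, let $\lambda$, $G$, $\rho_0$, $F$ be as in the context. Then there exists a unique solution $\rho$ to the discontinuous Volterra integral equation $$\rho_t=\rho_0\bar F(t)+\int_0^t\mathbb 1_{\{\rho_{u-}<1\}}\bar G(t-u)\lambda(u)\,du .$$ That is, there exists a unique function $\rho$ such that for all $t\in[0,T]$ $$\rho_t=\rho_0\bar F(t)+\int_0^t z(u)\bar G(t-u)\lambda(u)\,du,\qquad 0\le\rho_t\le1,$$ for some function $z$ on $[0,T]$ satisfying $$\mathbb 1_{\{\rho_t<1\}}\le z(t)\le1\quad\text{for a.e. }t\in[0,T].$$
   Context: $\lambda:[0,\infty)\to[0,\infty)$ is locally integrable (scaled arrival intensity); $G$ is a probability distribution function on $[0,\infty)$ (service times) with density $g$, and $\bar G=1-G$; $\rho_0\in[0,1]$; $F$ is a probability distribution function on $[0,\infty)$ (limiting distribution of the remaining service times of initially busy servers), and $\bar F=1-F$. These are the data of a sequence of $M_t/G/n/n$ loss queues: arrivals are nonhomogeneous Poisson of rate $n\lambda(\cdot)$, service times are sampled independently from $G$, there are $n$ servers and no buffer, the initial number in system $N^n_0$ satisfies $N_0^n/n\to\rho_0$ almost surely, and the remaining service times of initially busy servers follow $F^n$ with $\sup_t|F^n(t)-F(t)|\to0$. *)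

theory Defs
  imports "HOL-Probability.Probability"
begin

text \<open>Functions on \<open>[0,\<infinity>)\<close> are total functions on the reals whose values at negative
  arguments are left unconstrained (and are never used).\<close>

definition nonneg_cdf :: "(real \<Rightarrow> real) \<Rightarrow> bool" where
  "nonneg_cdf F \<longleftrightarrow>
     (\<exists>M. real_distribution M \<and> (AE x in M. 0 \<le> x) \<and> (\<forall>t\<ge>0. F t = cdf M t))"

definition nonneg_density :: "(real \<Rightarrow> real) \<Rightarrow> (real \<Rightarrow> real) \<Rightarrow> bool" where
  "nonneg_density G g \<longleftrightarrow>
     (\<forall>x\<ge>0. 0 \<le> g x) \<and>
     (\<forall>t\<ge>0. set_integrable lebesgue {0..t} g \<and> G t = (LINT x:{0..t}|lebesgue. g x))"

text \<open>The discontinuous Volterra equation on \<open>[0,T]\<close>, in its relaxed form: the indicator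
  \<open>\<rho> < 1\<close> is replaced by some function \<open>z\<close>, the same for all \<open>t\<close>, which lies between that
  indicator and \<open>1\<close> almost everywhere.  Measurability of \<open>z\<close> is implicit in the usual
  formulation; it has to be required here because a Bochner integral that does not exist is \<open>0\<close>.\<close>

definition loss_volterra_solution ::
    "real \<Rightarrow> (real \<Rightarrow> real) \<Rightarrow> (real \<Rightarrow> real) \<Rightarrow> real \<Rightarrow> (real \<Rightarrow> real) \<Rightarrow> (real \<Rightarrow> real) \<Rightarrow> bool" where
  "loss_volterra_solution T lam G \<rho>\<^sub>0 F \<rho> \<longleftrightarrow>
     (\<exists>z \<in> borel_measurable (lebesgue_on {0..T}).
        (\<forall>t\<in>{0..T}.
           \<rho> t = \<rho>\<^sub>0 * (1 - F t) + (LINT u:{0..t}|lebesgue. z u * (1 - G (t - u)) * lam u) \<and>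
           0 \<le> \<rho> t \<and> \<rho> t \<le> 1) \<and>
        (AE t in lebesgue_on {0..T}. indicat_real {s. \<rho> s < 1} t \<le> z t \<and> z t \<le> 1))"

end

theory Submission
  imports Defs
begin

text \<open>
  Put \<open>A t = \<integral>\<^sub>0\<^sup>t z \<lambda>\<close>, \<open>\<Lambda> t = \<integral>\<^sub>0\<^sup>t \<lambda>\<close> and \<open>B = \<Lambda> - A\<close> (the lost arrivals). Since \<open>G\<close> has density \<open>g\<close>,
  Fubini turns the Volterra equation into \<open>\<rho> = 1 + Y - B\<close> with
  \<open>Y = \<rho>\<^sub>0 (1 - F) + \<Lambda> - (\<Lambda> - B) * g - 1\<close>, where \<open>*\<close> is convolution. The bound \<open>\<rho> \<le> 1\<close> and the requirement \<open>z = 1\<close> a.e. on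
  \<open>\<rho> < 1\<close> say that \<open>B\<close> is the Skorokhod regulator of \<open>Y\<close>, that is,
  \<open>B t = sup {max 0 (Y s) | s \<le> t}\<close>. As \<open>Y\<close> depends on \<open>B\<close>, this is a fixed point problem. Its
  operator is monotone on the complete lattice of those \<open>B\<close> for which \<open>B\<close> and \<open>\<Lambda> - B\<close> are increasing,
  so Knaster-Tarski yields a fixed point; on time windows of length \<open>\<delta>\<close> with \<open>G \<delta> < 1\<close> it is a
  contraction in the supremum norm, so there is only one. The control \<open>z\<close> is recovered from \<open>B\<close> by the
  Radon-Nikodym theorem.
\<close>

section \<open>Primitives and convolutions\<close>

text \<open>Integrating over all of \<open>{..t}\<close> makes sense at every real \<open>t\<close>.
  For functions that vanish at negative arguments it is the integral over \<open>{0..t}\<close>,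
  with value 0 for \<open>t \<le> 0\<close>.\<close>

definition primitive :: "(real \<Rightarrow> real) \<Rightarrow> real \<Rightarrow> real" where
  "primitive f t = (\<integral>u. f u * indicator {..t} u \<partial>lborel)"

definition convolve :: "(real \<Rightarrow> real) \<Rightarrow> (real \<Rightarrow> real) \<Rightarrow> real \<Rightarrow> real" where
  "convolve f k t = (\<integral>r. f (t - r) * k r \<partial>lborel)"

lemma integrable_bounded_times:
  fixes f k :: "real \<Rightarrow> real"
  assumes [measurable]: "f \<in> borel_measurable borel" and "\<And>x. \<bar>f x\<bar> \<le> C" and k: "integrable lborel k"
  shows "integrable lborel (\<lambda>x. f x * k x)"
proof -
  note [measurable] = borel_measurable_integrable[OF k]
  have "\<bar>f x * k x\<bar> \<le> \<bar>C * k x\<bar>" for x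
    unfolding abs_mult by (rule mult_right_mono) (use assms(2)[of x] in auto)
  then show ?thesis
    by (intro Bochner_Integration.integrable_bound[OF integrable_mult_right[OF k, of C]]) auto
qed

lemma integrable_convolve:
  fixes f k :: "real \<Rightarrow> real"
  assumes [measurable]: "f \<in> borel_measurable borel" and "\<And>x. \<bar>f x\<bar> \<le> C" and "integrable lborel k"
  shows "integrable lborel (\<lambda>r. f (t - r) * k r)"
  by (rule integrable_bounded_times[where C = C]) (use assms(2,3) in auto)

lemma integrable_times_atMost:
  assumes "integrable lborel (f :: real \<Rightarrow> real)"
  shows "integrable lborel (\<lambda>u. f u * indicator {..t} u)"
  using assms by (intro Bochner_Integration.integrable_bound[OF assms]) (auto simp: indicator_def)

lemma primitive_diff:
  assumes f: "integrable lborel f" and st: "s \<le> t"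
  shows "primitive f t - primitive f s = (\<integral>u. f u * indicator {s<..t} u \<partial>lborel)"
proof -
  have "primitive f t - primitive f s =
      (\<integral>u. f u * indicator {..t} u - f u * indicator {..s} u \<partial>lborel)"
    unfolding primitive_def
    by (rule Bochner_Integration.integral_diff[symmetric]; rule integrable_times_atMost[OF f])
  also have "\<dots> = (\<integral>u. f u * indicator {s<..t} u \<partial>lborel)"
    using st by (intro Bochner_Integration.integral_cong) (auto simp: indicator_def)
  finally show ?thesis .
qed

lemma mono_primitive:
  assumes "integrable lborel f" "\<And>u. 0 \<le> f u"
  shows "mono (primitive f)"
proof (rule monoI)
  fix s t :: real assume "s \<le> t"
  have "0 \<le> (\<integral>u. f u * indicator {s<..t} u \<partial>lborel)"
    using assms(2) by (intro Bochner_Integration.integral_nonneg) auto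
  with primitive_diff[OF assms(1) \<open>s \<le> t\<close>] show "primitive f s \<le> primitive f t" by simp
qed

lemma primitive_nonneg: "(\<And>u. 0 \<le> f u) \<Longrightarrow> 0 \<le> primitive f t"
  unfolding primitive_def by (intro Bochner_Integration.integral_nonneg) auto

lemma primitive_le_integral:
  assumes "integrable lborel f" "\<And>u. 0 \<le> f u"
  shows "primitive f t \<le> integral\<^sup>L lborel f"
  unfolding primitive_def
  using assms integrable_times_atMost[OF assms(1)]
  by (intro integral_mono) (auto simp: indicator_def)

lemma primitive_eq_0:
  assumes "\<And>u. u < 0 \<Longrightarrow> f u = 0" "t \<le> 0"
  shows "primitive f t = 0"
proof -
  have "AE u in lborel. u \<noteq> (0::real)" by (rule AE_lborel_singleton)
  then have "AE u in lborel. f u * indicator {..t} u = 0"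
    by eventually_elim (use assms in \<open>auto simp: indicator_def\<close>)
  then show ?thesis
    unfolding primitive_def by (rule integral_eq_zero_AE)
qed

text \<open>Lebesgue measure has no atoms: the indicators of \<open>{..x n}\<close> converge at
  every point other than \<open>t\<close>, and the absolute value of \<open>f\<close>
  dominates.\<close>

lemma isCont_primitive:
  assumes f: "integrable lborel f"
  shows "isCont (primitive f) t"
proof (rule continuous_at_sequentiallyI)
  fix x :: "nat \<Rightarrow> real" assume x: "x \<longlonglongrightarrow> t"
  note [measurable] = borel_measurable_integrable[OF f]
  show "(\<lambda>n. primitive f (x n)) \<longlonglongrightarrow> primitive f t"
    unfolding primitive_def
  proof (rule integral_dominated_convergence[where w = "\<lambda>u. \<bar>f u\<bar>"])
    have "AE u in lborel. u \<noteq> t" by (rule AE_lborel_singleton)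
    then show "AE u in lborel. (\<lambda>n. f u * indicator {..x n} u) \<longlonglongrightarrow> f u * indicator {..t} u"
    proof eventually_elim
      fix u assume "u \<noteq> t"
      then consider "u < t" | "t < u" by linarith
      then have "\<forall>\<^sub>F n in sequentially. f u * indicator {..x n} u = f u * indicator {..t} u"
      proof cases
        case 1
        show ?thesis
          using order_tendstoD(1)[OF x 1] by eventually_elim (use 1 in auto)
      next
        case 2
        show ?thesis
          using order_tendstoD(2)[OF x 2] by eventually_elim (use 2 in auto)
      qed
      then show "(\<lambda>n. f u * indicator {..x n} u) \<longlonglongrightarrow> f u * indicator {..t} u"
        by (rule tendsto_eventually)
    qed
  qed (use f in \<open>auto simp: indicator_def\<close>)
qed

lemma isCont_convolve:
  assumes f: "\<And>x. isCont f x" and C: "\<And>x. \<bar>f x\<bar> \<le> C" and k: "integrable lborel k"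
  shows "isCont (convolve f k) t"
proof (rule continuous_at_sequentiallyI)
  fix x :: "nat \<Rightarrow> real" assume x: "x \<longlonglongrightarrow> t"
  note [measurable] = borel_measurable_integrable[OF k]
  have [measurable]: "f \<in> borel_measurable borel"
    using f by (intro borel_measurable_continuous_onI) (simp add: continuous_at_imp_continuous_on)
  show "(\<lambda>n. convolve f k (x n)) \<longlonglongrightarrow> convolve f k t"
    unfolding convolve_def
  proof (rule integral_dominated_convergence[where w = "\<lambda>r. C * \<bar>k r\<bar>"])
    show "AE r in lborel. (\<lambda>n. f (x n - r) * k r) \<longlonglongrightarrow> f (t - r) * k r"
      by (intro AE_I2 tendsto_intros isCont_tendsto_compose[OF f] x)
    show "AE r in lborel. norm (f (x n - r) * k r) \<le> C * \<bar>k r\<bar>" for n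
      using C by (auto simp: abs_mult intro!: mult_right_mono)
  qed (use k in auto)
qed

text \<open>Both sides integrate \<open>a u * k r\<close> over the half-plane
  \<open>u + r \<le> t\<close>, in the two orders that Fubini allows. This trades a kernel given by
  a distribution function for a convolution with its density.\<close>

lemma convolve_primitive:
  assumes a: "integrable lborel a" and k: "integrable lborel k"
  shows "convolve (primitive a) k t = (\<integral>u. a u * primitive k (t - u) \<partial>lborel)"
proof -
  note [measurable] = borel_measurable_integrable[OF a] borel_measurable_integrable[OF k]
  define f where "f u r = a u * k r * indicator {..t} (u + r)" for u r :: real
  have [measurable]: "case_prod f \<in> borel_measurable (lborel \<Otimes>\<^sub>M lborel)"
    unfolding f_def by measurable
  have prod: "integrable (lborel \<Otimes>\<^sub>M lborel) (\<lambda>(u, r). a u * k r)"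
  proof (rule lborel_pair.Fubini_integrable)
    show "integrable lborel (\<lambda>x. LINT y|lborel. norm (case (x, y) of (u, r) \<Rightarrow> a u * k r))"
      using a k by (simp add: abs_mult)
  qed (use k in auto)
  have "integrable (lborel \<Otimes>\<^sub>M lborel) (case_prod f)"
    by (rule Bochner_Integration.integrable_bound[OF prod]) (auto simp: f_def indicator_def)
  from lborel_pair.Fubini_integral[OF this]
  have "(\<integral>r. (\<integral>u. f u r \<partial>lborel) \<partial>lborel) = (\<integral>u. (\<integral>r. f u r \<partial>lborel) \<partial>lborel)" .
  also have "(\<lambda>r. \<integral>u. f u r \<partial>lborel) = (\<lambda>r. primitive a (t - r) * k r)"
  proof
    fix r
    have "(\<integral>u. f u r \<partial>lborel) = (\<integral>u. a u * indicator {..t - r} u * k r \<partial>lborel)"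
      by (intro Bochner_Integration.integral_cong) (auto simp: f_def indicator_def)
    then show "(\<integral>u. f u r \<partial>lborel) = primitive a (t - r) * k r"
      by (simp add: primitive_def)
  qed
  also have "(\<lambda>u. \<integral>r. f u r \<partial>lborel) = (\<lambda>u. a u * primitive k (t - u))"
  proof
    fix u
    have "(\<integral>r. f u r \<partial>lborel) = (\<integral>r. a u * (k r * indicator {..t - u} r) \<partial>lborel)"
      by (intro Bochner_Integration.integral_cong) (auto simp: f_def indicator_def)
    then show "(\<integral>r. f u r \<partial>lborel) = a u * primitive k (t - u)"
      by (simp add: primitive_def)
  qed
  finally show ?thesis by (simp add: convolve_def)
qed

lemma primitive_ae_eq:
  assumes "integrable lborel a" "integrable lborel b" "s \<le> t"
    and "AE u in lborel. s < u \<longrightarrow> u \<le> t \<longrightarrow> a u = b u"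
  shows "primitive a t - primitive a s = primitive b t - primitive b s"
  unfolding primitive_diff[OF assms(1,3)] primitive_diff[OF assms(2,3)]
proof (rule integral_cong_AE)
  show "AE u in lborel. a u * indicator {s<..t} u = b u * indicator {s<..t} u"
    using assms(4) by eventually_elim (auto simp: indicator_def)
qed (use assms(1,2)[THEN borel_measurable_integrable] in auto)

section \<open>Radon-Nikodym densities of continuous increasing functions\<close>

lemma emeasure_density_primitive:
  assumes l: "integrable lborel l" "\<And>u. 0 \<le> l u" and "s \<le> t"
  shows "emeasure (density lborel l) {s<..t} = primitive l t - primitive l s"
proof -
  note [measurable] = borel_measurable_integrable[OF l(1)]
  have int: "integrable lborel (\<lambda>u. l u * indicator {s<..t} u)"
    using l(1) by (rule Bochner_Integration.integrable_bound) (auto simp: indicator_def)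
  have "emeasure (density lborel l) {s<..t} = (\<integral>\<^sup>+u. ennreal (l u * indicator {s<..t} u) \<partial>lborel)"
    by (subst emeasure_density) (auto intro!: nn_integral_cong simp: indicator_def)
  also have "\<dots> = primitive l t - primitive l s"
    using l(2) by (subst nn_integral_eq_integral[OF int])
      (auto simp: primitive_diff[OF l(1) \<open>s \<le> t\<close>])
  finally show ?thesis .
qed

text \<open>The Stieltjes measures of \<open>A\<close> and \<open>B\<close> add up to the measure
  with density \<open>l\<close>, so each is absolutely continuous with respect to it, and their
  densities sum to 1 because densities are unique.\<close>

lemma interval_measure_densities:
  fixes A B :: "real \<Rightarrow> real"
  assumes l: "integrable lborel l" "\<And>u. 0 \<le> l u"
    and A: "mono A" "\<And>t. isCont A t" and B: "mono B" "\<And>t. isCont B t"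
    and AB: "\<And>t. A t + B t = primitive l t"
  obtains f g where "f \<in> borel_measurable borel" "g \<in> borel_measurable borel"
    "density (density lborel l) f = interval_measure A"
    "density (density lborel l) g = interval_measure B"
    "AE u in density lborel l. f u + g u = (1 :: ennreal)"
proof -
  note [measurable] = borel_measurable_integrable[OF l(1)]
  let ?M = "density lborel l"
  have right: "continuous (at_right t) A" "continuous (at_right t) B" for t
    using A(2) B(2) by (auto intro: continuous_at_imp_continuous_at_within)
  \<comment> \<open>\<open>N\<close> is the setwise sum of the two Stieltjes measures. By
    \<open>AB\<close> it agrees with \<open>?M\<close> on half-open intervals, hence
    everywhere.\<close>
  define N where "N = measure_of UNIV (sets borel)
    (\<lambda>S. emeasure (interval_measure A) S + emeasure (interval_measure B) S)"
  have sets_N [measurable_cong]: "sets N = sets borel"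
    unfolding N_def using sets.sigma_sets_eq[of borel] by (subst sets_measure_of) auto
  have N: "emeasure N S = emeasure (interval_measure A) S + emeasure (interval_measure B) S"
    if "S \<in> sets borel" for S
  proof (rule emeasure_measure_of[OF N_def])
    show "countably_additive (sets N)
      (\<lambda>S. emeasure (interval_measure A) S + emeasure (interval_measure B) S)"
      unfolding countably_additive_def sets_N
      by (auto simp: suminf_add[symmetric] suminf_emeasure)
  qed (use that in \<open>auto simp: sets_N positive_def\<close>)
  have "N = ?M"
  proof (rule measure_eqI_generator_eq[where E = "range (\<lambda>(a, b). {a<..b::real})"
        and \<Omega> = UNIV and A = "\<lambda>n. {- real n<..real n}"])
    have sigma: "sets borel = sigma_sets UNIV (range (\<lambda>(a, b). {a<..b::real}))"
      by (subst borel_sigma_sets_Ioc) simp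
    show "sets N = sigma_sets UNIV (range (\<lambda>(a, b). {a<..b::real}))"
      "sets ?M = sigma_sets UNIV (range (\<lambda>(a, b). {a<..b::real}))"
      using sigma sets_N by auto
    have eq: "emeasure N {a<..b} = ennreal (primitive l b - primitive l a)" if "a \<le> b" for a b
    proof -
      have "primitive l b - primitive l a = (A b - A a) + (B b - B a)"
        using AB[of a] AB[of b] by simp
      then show ?thesis
        using that A(1) B(1)
        by (simp add: N emeasure_interval_measure_Ioc right monoD flip: ennreal_plus)
    qed
    then show "emeasure N X = emeasure ?M X" if "X \<in> range (\<lambda>(a, b). {a<..b::real})" for X
    proof -
      from that obtain a b where X: "X = {a<..b}" by auto
      show ?thesis
        using eq[of a b] emeasure_density_primitive[OF l, of a b] X by (cases "a \<le> b") auto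
    qed
    show "emeasure N {- real n<..real n} \<noteq> \<infinity>" for n
      using eq[of "- real n" "real n"] by simp
    show "Int_stable (range (\<lambda>(a, b). {a<..b::real}))"
      by (auto simp: Int_stable_def Int_greaterThanAtMost)
    show "(\<Union>n. {- real n<..real n}) = UNIV"
    proof (intro set_eqI iffI UNIV_I)
      fix x :: real
      obtain n where "\<bar>x\<bar> < real n" using reals_Archimedean2 by blast
      then show "x \<in> (\<Union>n. {- real n<..real n})" by (intro UN_I[of n]) auto
    qed
  qed auto
  have "finite_measure ?M"
  proof
    have "emeasure ?M (space ?M) = (\<integral>\<^sup>+u. ennreal (l u) \<partial>lborel)"
      by (simp add: emeasure_density)
    also have "\<dots> = ennreal (integral\<^sup>L lborel l)"
      using l by (intro nn_integral_eq_integral) auto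
    finally show "emeasure ?M (space ?M) \<noteq> \<infinity>" by simp
  qed
  then interpret M: finite_measure ?M .
  \<comment> \<open>A null set of the sum \<open>N\<close> is null for both summands.\<close>
  have "absolutely_continuous ?M (interval_measure A)" "absolutely_continuous ?M (interval_measure B)"
    unfolding absolutely_continuous_def \<open>N = ?M\<close>[symmetric]
    by (auto simp: null_sets_def sets_N N)
  then obtain f g where fg [measurable]: "f \<in> borel_measurable borel" "g \<in> borel_measurable borel"
    and d: "density ?M f = interval_measure A" "density ?M g = interval_measure B"
    using M.Radon_Nikodym[of "interval_measure A"] M.Radon_Nikodym[of "interval_measure B"]
    by auto
  have "density ?M (\<lambda>u. f u + g u) = density ?M (\<lambda>_. 1)"
  proof (rule measure_eqI)
    fix S assume "S \<in> sets (density ?M (\<lambda>u. f u + g u))"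
    then have S [measurable]: "S \<in> sets borel" by simp
    have "emeasure (density ?M (\<lambda>u. f u + g u)) S = emeasure (density ?M f) S + emeasure (density ?M g) S"
      by (subst (1 2 3) emeasure_density) (auto simp: distrib_right nn_integral_add)
    also have "\<dots> = emeasure ?M S"
      using N[OF S] d \<open>N = ?M\<close> by simp
    finally show "emeasure (density ?M (\<lambda>u. f u + g u)) S = emeasure (density ?M (\<lambda>_. 1)) S"
      by (simp add: density_1)
  qed simp
  then have "AE u in ?M. f u + g u = 1"
    by (intro M.density_unique) auto
  with fg d that show ?thesis by blast
qed

text \<open>A Lebesgue measurable function agrees almost everywhere with a Borel one. Cutting it off
  outside \<open>{0..T}\<close> and taking the positive part gives a function that is integrable and
  nonnegative on the whole line, fit for Fubini and Stieltjes measures over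
  \<open>lborel\<close>.\<close>

lemma ex_borel_version:
  fixes f :: "real \<Rightarrow> real"
  assumes f: "set_integrable lebesgue {0..T} f" and nonneg: "\<And>x. x \<in> {0..T} \<Longrightarrow> 0 \<le> f x"
  obtains f' where "integrable lborel f'" "\<And>x. 0 \<le> f' x" "\<And>x. x \<notin> {0..T} \<Longrightarrow> f' x = 0"
    "AE x in lborel. x \<in> {0..T} \<longrightarrow> f x = f' x"
proof -
  define f0 where "f0 x = indicator {0..T} x * f x" for x
  have f0: "integrable lebesgue f0"
    using f by (simp add: set_integrable_def f0_def[abs_def])
  then obtain k where k [measurable]: "k \<in> borel_measurable lborel" and eq: "AE x in lborel. f0 x = k x"
    using completion_ex_borel_measurable_real[of f0 lborel] by auto
  define f' where "f' x = indicator {0..T} x * max 0 (k x)" for x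
  have [measurable]: "f' \<in> borel_measurable lborel" unfolding f'_def by measurable
  have ae: "AE x in lborel. f0 x = f' x"
    using eq
  proof eventually_elim
    case (elim x)
    then show ?case
      using nonneg[of x] by (cases "x \<in> {0..T}") (auto simp: f0_def f'_def max_def)
  qed
  have "integrable lebesgue f'"
    using f0 AE_completion[OF ae]
    by (subst integrable_cong_AE[of _ _ f0]) (auto intro: measurable_completion)
  then have "integrable lborel f'" by (simp add: integrable_completion)
  moreover have "AE x in lborel. x \<in> {0..T} \<longrightarrow> f x = f' x"
    using ae by eventually_elim (auto simp: f0_def)
  ultimately show ?thesis by (intro that[of f']) (auto simp: f'_def)
qed

lemma ex_borel_version_unit:
  fixes z :: "real \<Rightarrow> real"
  assumes z: "z \<in> borel_measurable (lebesgue_on {0..T})"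
    and bounds: "AE x in lborel. x \<in> {0..T} \<longrightarrow> 0 \<le> z x \<and> z x \<le> 1"
  obtains z' where "z' \<in> borel_measurable borel" "\<And>x. 0 \<le> z' x" "\<And>x. z' x \<le> 1"
    "AE x in lborel. x \<in> {0..T} \<longrightarrow> z x = z' x"
proof -
  have "(\<lambda>x. indicator {0..T} x *\<^sub>R z x) \<in> borel_measurable lebesgue"
    using z by (subst (asm) borel_measurable_restrict_space_iff) auto
  from completion_ex_borel_measurable_real[OF this]
  obtain k where k [measurable]: "k \<in> borel_measurable lborel"
    and eq: "AE x in lborel. indicator {0..T} x *\<^sub>R z x = k x" by auto
  show ?thesis
  proof (rule that[of "\<lambda>x. max 0 (min 1 (k x))"])
    show "AE x in lborel. x \<in> {0..T} \<longrightarrow> z x = max 0 (min 1 (k x))"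
      using eq bounds by eventually_elim auto
  qed (use k in auto)
qed

section \<open>The reflection operator and its fixed points\<close>

text \<open>Here \<open>l\<close> stands for the arrival rate, \<open>h\<close> for the service
  density and \<open>p\<close> for the initial customers still present. Only one-sided continuity is
  asked of \<open>p\<close>, since \<open>F\<close> may jump.\<close>

locale reflected_volterra =
  fixes l h p :: "real \<Rightarrow> real"
  assumes integrable_l: "integrable lborel l" and l_nonneg: "0 \<le> l t" and l_neg: "t < 0 \<Longrightarrow> l t = 0"
    and integrable_h: "integrable lborel h" and h_nonneg: "0 \<le> h t" and h_neg: "t < 0 \<Longrightarrow> h t = 0"
    and antimono_p: "antimono p" and p_le_1: "p t \<le> 1"
    and p_right_cont: "continuous (at_right t) p"
begin

text \<open>Both monotonicity conditions survive pointwise suprema. Together they force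
  \<open>B\<close> to be continuous, since its increments lie between 0 and those of
  \<open>primitive l\<close>.\<close>

definition admissible :: "(real \<Rightarrow> real) \<Rightarrow> bool" where
  "admissible B \<longleftrightarrow> (\<forall>t\<le>0. B t = 0) \<and> mono B \<and> mono (\<lambda>t. primitive l t - B t)"

definition excess :: "(real \<Rightarrow> real) \<Rightarrow> real \<Rightarrow> real" where
  "excess B t = p t + primitive l t - convolve (\<lambda>s. primitive l s - B s) h t - 1"

text \<open>Letting the supremum range over negative times does no harm: for admissible
  \<open>B\<close> the excess is at most \<open>primitive l\<close>, which vanishes there.\<close>

definition regulator :: "(real \<Rightarrow> real) \<Rightarrow> real \<Rightarrow> real" where
  "regulator B t = (SUP s\<in>{..t}. max 0 (excess B s))"

lemma primitive_l_0: "t \<le> 0 \<Longrightarrow> primitive l t = 0"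
  using primitive_eq_0 l_neg by blast

lemma mono_primitive_l: "mono (primitive l)"
  by (rule mono_primitive[OF integrable_l l_nonneg])

lemma primitive_l_nonneg: "0 \<le> primitive l t"
  by (rule primitive_nonneg[OF l_nonneg])

lemma primitive_l_le: "primitive l t \<le> integral\<^sup>L lborel l"
  by (rule primitive_le_integral[OF integrable_l l_nonneg])

section \<open>Excess and regulator of one admissible function\<close>

context
  fixes B :: "real \<Rightarrow> real"
  assumes B: "admissible B"
begin

lemma admissible_0: "t \<le> 0 \<Longrightarrow> B t = 0"
  and admissible_mono: "s \<le> t \<Longrightarrow> B s \<le> B t"
  and admissible_increment: "s \<le> t \<Longrightarrow> B t - B s \<le> primitive l t - primitive l s"
proof -
  assume "s \<le> t"
  from B have "mono (\<lambda>t. primitive l t - B t)" by (simp add: admissible_def)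
  from monoD[OF this \<open>s \<le> t\<close>] show "B t - B s \<le> primitive l t - primitive l s" by simp
qed (use B in \<open>auto simp: admissible_def mono_def\<close>)

lemma admissible_nonneg: "0 \<le> B t"
  using admissible_mono[of 0 t] admissible_0[of 0] admissible_0[of t] by (cases "0 \<le> t") auto

lemma admissible_le: "B t \<le> primitive l t"
  using admissible_increment[of 0 t] admissible_0[of 0] admissible_0[of t]
    primitive_l_0[of 0] primitive_l_0[of t] by (cases "0 \<le> t") auto

lemma isCont_admissible: "isCont B t"
  unfolding isCont_def
proof (rule Lim_null[THEN iffD2], rule Lim_null_comparison)
  show "\<forall>\<^sub>F x in at t. norm (B x - B t) \<le> \<bar>primitive l x - primitive l t\<bar>"
  proof (intro always_eventually allI)
    fix x
    show "norm (B x - B t) \<le> \<bar>primitive l x - primitive l t\<bar>"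
      using admissible_mono[of x t] admissible_increment[of x t]
        admissible_mono[of t x] admissible_increment[of t x] by (cases "x \<le> t") auto
  qed
  have "((\<lambda>x. primitive l x - primitive l t) \<longlongrightarrow> 0) (at t)"
    using isCont_primitive[OF integrable_l] unfolding isCont_def by (rule Lim_null[THEN iffD1])
  then show "((\<lambda>x. \<bar>primitive l x - primitive l t\<bar>) \<longlongrightarrow> 0) (at t)"
    by (rule tendsto_rabs_zero)
qed

lemma continuous_on_admissible: "continuous_on S B"
  using isCont_admissible by (simp add: continuous_at_imp_continuous_on)

lemma abs_primitive_diff_le: "\<bar>primitive l t - B t\<bar> \<le> integral\<^sup>L lborel l"
  using admissible_nonneg[of t] admissible_le[of t] primitive_l_le[of t] by auto

lemma isCont_primitive_diff: "isCont (\<lambda>s. primitive l s - B s) t"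
  by (intro continuous_intros isCont_primitive integrable_l isCont_admissible)

lemma measurable_primitive_diff: "(\<lambda>s. primitive l s - B s) \<in> borel_measurable borel"
  using isCont_primitive_diff
  by (intro borel_measurable_continuous_onI) (simp add: continuous_at_imp_continuous_on)

lemma integrable_convolve_diff: "integrable lborel (\<lambda>r. (primitive l (t - r) - B (t - r)) * h r)"
  by (rule integrable_convolve[where f = "\<lambda>s. primitive l s - B s"])
     (use abs_primitive_diff_le integrable_h measurable_primitive_diff in auto)

lemma convolve_diff_mono:
  assumes "s \<le> t"
  shows "convolve (\<lambda>s. primitive l s - B s) h s \<le> convolve (\<lambda>s. primitive l s - B s) h t"
  unfolding convolve_def
proof (rule integral_mono)
  fix r
  show "(primitive l (s - r) - B (s - r)) * h r \<le> (primitive l (t - r) - B (t - r)) * h r"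
    using admissible_increment[of "s - r" "t - r"] assms h_nonneg[of r]
    by (intro mult_right_mono) auto
qed (rule integrable_convolve_diff)+

lemma convolve_diff_nonneg: "0 \<le> convolve (\<lambda>s. primitive l s - B s) h t"
  unfolding convolve_def
  using admissible_le h_nonneg by (intro Bochner_Integration.integral_nonneg) auto

lemma excess_le: "excess B t \<le> primitive l t"
  using convolve_diff_nonneg[of t] p_le_1[of t] by (simp add: excess_def)

text \<open>As time passes \<open>p\<close> falls and the convolution grows, so only arrivals can
  raise the excess. This is what keeps the increments of the regulator below those of
  \<open>primitive l\<close>.\<close>

lemma excess_increment: "s \<le> t \<Longrightarrow> excess B t - excess B s \<le> primitive l t - primitive l s"
  using convolve_diff_mono[of s t] antimonoD[OF antimono_p, of s t] by (simp add: excess_def)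

lemma bdd_above_excess: "bdd_above ((\<lambda>s. max 0 (excess B s)) ` {..t})"
proof (rule bdd_aboveI2)
  fix s assume "s \<in> {..t}"
  then show "max 0 (excess B s) \<le> primitive l t"
    using excess_le[of s] monoD[OF mono_primitive_l, of s t] primitive_l_nonneg[of t] by auto
qed

lemma regulator_upper: "s \<le> t \<Longrightarrow> excess B s \<le> regulator B t"
  unfolding regulator_def
  by (rule order_trans[OF max.cobounded2 cSUP_upper[OF _ bdd_above_excess]]) auto

lemma regulator_nonneg: "0 \<le> regulator B t"
  unfolding regulator_def
  by (rule order_trans[OF max.cobounded1 cSUP_upper[OF _ bdd_above_excess]]) auto

lemma regulator_least:
  assumes "0 \<le> c" "\<And>s. s \<le> t \<Longrightarrow> excess B s \<le> c"
  shows "regulator B t \<le> c"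
  unfolding regulator_def using assms by (intro cSUP_least) auto

lemma regulator_mono: "s \<le> t \<Longrightarrow> regulator B s \<le> regulator B t"
  by (intro regulator_least regulator_nonneg regulator_upper) auto

lemma admissible_regulator: "admissible (regulator B)"
proof -
  have "regulator B t = 0" if "t \<le> 0" for t
  proof (rule antisym[OF _ regulator_nonneg], rule regulator_least)
    fix s assume "s \<le> t"
    with that excess_le[of s] primitive_l_0[of s] show "excess B s \<le> 0" by simp
  qed simp
  moreover have "regulator B t \<le> regulator B s + (primitive l t - primitive l s)" if "s \<le> t" for s t
  proof (rule regulator_least)
    fix u assume "u \<le> t"
    have l: "primitive l s \<le> primitive l t" "primitive l u \<le> primitive l t"
      using monoD[OF mono_primitive_l] that \<open>u \<le> t\<close> by auto
    \<comment> \<open>For \<open>u > s\<close> the excess gains at most the arrivals between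
      \<open>s\<close> and \<open>u\<close>, and its value at \<open>s\<close> is already below the
      regulator.\<close>
    show "excess B u \<le> regulator B s + (primitive l t - primitive l s)"
      using regulator_upper[of u s] regulator_upper[of s s] excess_increment[of s u] l
      by (cases "u \<le> s") auto
  qed (use monoD[OF mono_primitive_l that] regulator_nonneg[of s] in simp)
  ultimately show ?thesis
    unfolding admissible_def by (auto simp: mono_def regulator_mono algebra_simps)
qed

end

section \<open>Comparison of two admissible functions and existence of a fixed point\<close>

lemma excess_diff:
  assumes B: "admissible B" and C: "admissible C"
  shows "excess B t - excess C t = (\<integral>r. (B (t - r) - C (t - r)) * h r \<partial>lborel)"
proof -
  have "excess B t - excess C t =
      (\<integral>r. (primitive l (t - r) - C (t - r)) * h r \<partial>lborel) -
      (\<integral>r. (primitive l (t - r) - B (t - r)) * h r \<partial>lborel)"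
    by (simp add: excess_def convolve_def)
  also have "\<dots> = (\<integral>r. (primitive l (t - r) - C (t - r)) * h r -
      (primitive l (t - r) - B (t - r)) * h r \<partial>lborel)"
    by (rule Bochner_Integration.integral_diff[symmetric]; rule integrable_convolve_diff) fact+
  finally show ?thesis by (simp add: algebra_simps)
qed

text \<open>The one-sided form of the fact that a running maximum is 1-Lipschitz in the supremum
  norm.\<close>

lemma regulator_le_add:
  assumes B: "admissible B" and C: "admissible C" and "0 \<le> c"
    and *: "\<And>s. s \<le> t \<Longrightarrow> excess B s \<le> excess C s + c"
  shows "regulator B t \<le> regulator C t + c"
proof (rule regulator_least[OF B])
  fix s assume "s \<le> t"
  then show "excess B s \<le> regulator C t + c"
    using * regulator_upper[OF C] by (meson add_right_mono order_trans)
qed (use \<open>0 \<le> c\<close> regulator_nonneg[OF C] in simp)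

lemma integrable_excess_diff:
  assumes B: "admissible B" and C: "admissible C"
  shows "integrable lborel (\<lambda>r. (B (t - r) - C (t - r)) * h r)"
  using Bochner_Integration.integrable_diff[OF integrable_convolve_diff[OF C, of t] integrable_convolve_diff[OF B, of t]]
  by (simp add: algebra_simps)

text \<open>More losses mean fewer accepted arrivals, hence fewer departures and a larger
  excess.\<close>

lemma excess_mono:
  assumes B: "admissible B" and C: "admissible C" and "\<And>t. B t \<le> C t"
  shows "excess B t \<le> excess C t"
proof -
  have "0 \<le> excess C t - excess B t"
    unfolding excess_diff[OF C B]
    using assms(3) h_nonneg by (intro Bochner_Integration.integral_nonneg) auto
  then show ?thesis by simp
qed

lemma regulator_monotone:
  assumes B: "admissible B" and C: "admissible C" and "\<And>t. B t \<le> C t"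
  shows "regulator B t \<le> regulator C t"
  using regulator_le_add[OF B C, of 0] excess_mono[OF assms] by simp

text \<open>The Knaster-Tarski argument carried out directly: the fixed point is the pointwise
  supremum of all admissible functions that lie below their own regulator.\<close>

lemma ex_regulator_fixpoint: "\<exists>B. admissible B \<and> regulator B = B"
proof -
  define P where "P = {B. admissible B \<and> (\<forall>t. B t \<le> regulator B t)}"
  define S where "S t = (SUP B\<in>P. B t)" for t
  have zero: "admissible (\<lambda>_. 0)"
    using mono_primitive_l by (auto simp: admissible_def intro: monoI)
  then have ne: "P \<noteq> {}"
    using regulator_nonneg[OF zero] by (auto simp: P_def)
  have bdd: "bdd_above ((\<lambda>B. B t) ` P)" for t
    by (rule bdd_aboveI2[where M = "primitive l t"]) (auto simp: P_def admissible_le)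
  have upper: "B t \<le> S t" if "B \<in> P" for B t
    unfolding S_def by (rule cSUP_upper[OF that bdd])
  have least: "S t \<le> c" if "\<And>B. B \<in> P \<Longrightarrow> B t \<le> c" for t c
    unfolding S_def by (rule cSUP_least[OF ne that])
  have S: "admissible S"
    unfolding admissible_def
  proof (intro conjI monoI allI impI)
    fix t :: real assume "t \<le> 0"
    then have "B t = 0" if "B \<in> P" for B
      using that by (auto simp: P_def admissible_0)
    then have "S t = (SUP B\<in>P. 0)"
      unfolding S_def by (rule SUP_cong[OF refl])
    then show "S t = 0"
      using ne by simp
  next
    fix s t :: real assume "s \<le> t"
    show "S s \<le> S t"
    proof (rule least)
      fix B assume "B \<in> P"
      then show "B s \<le> S t"
        using upper[of B t] admissible_mono[of B, OF _ \<open>s \<le> t\<close>] by (auto simp: P_def)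
    qed
    have "S t \<le> S s + (primitive l t - primitive l s)"
    proof (rule least)
      fix B assume "B \<in> P"
      then show "B t \<le> S s + (primitive l t - primitive l s)"
        using upper[of B s] admissible_increment[of B, OF _ \<open>s \<le> t\<close>] by (auto simp: P_def)
    qed
    then show "primitive l s - S s \<le> primitive l t - S t" by simp
  qed
  have le: "S t \<le> regulator S t" for t
  proof (rule least)
    fix B assume "B \<in> P"
    then have "B t \<le> regulator B t" "regulator B t \<le> regulator S t"
      using regulator_monotone[OF _ S, of B] upper by (auto simp: P_def)
    then show "B t \<le> regulator S t" by simp
  qed
  \<comment> \<open>By monotonicity the regulator of \<open>S\<close> lies in \<open>P\<close>
    again, so it cannot exceed the supremum \<open>S\<close>.\<close>
  have "regulator S \<in> P"
    using admissible_regulator[OF S] regulator_monotone[OF S admissible_regulator[OF S] le]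
    by (simp add: P_def)
  from upper[OF this] le have "regulator S = S"
    by (intro ext antisym)
  with S show ?thesis by blast
qed

section \<open>Uniqueness of the fixed point by contraction on short windows\<close>

lemma ex_small_window: "\<exists>\<delta>>0. primitive h \<delta> < 1"
proof -
  have "primitive h 0 = 0" by (rule primitive_eq_0) (use h_neg in auto)
  with isCont_primitive[OF integrable_h, of 0]
  have "((primitive h) \<longlongrightarrow> 0) (at_right 0)"
    by (simp add: isCont_def filterlim_at_split)
  from order_tendstoD(2)[OF this, of 1]
  obtain b where "b > 0" "\<forall>y>0. y < b \<longrightarrow> primitive h y < 1"
    by (auto simp: eventually_at_right_field)
  then show ?thesis
    by (intro exI[of _ "b / 2"]) auto
qed

text \<open>If \<open>B\<close> exceeded \<open>C\<close> somewhere, let \<open>t0\<close> be the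
  infimum of such times. Up to time \<open>t0 + \<delta>\<close> the regulators differ by at most
  \<open>primitive h \<delta> < 1\<close> times the largest gap, so there is no gap there, against
  the choice of \<open>t0\<close>.\<close>

lemma regulator_fixpoint_le:
  assumes B: "admissible B" "regulator B = B" and C: "admissible C" "regulator C = C"
  shows "B t \<le> C t"
proof (rule ccontr)
  assume "\<not> B t \<le> C t"
  define S where "S = {s. C s < B s}"
  have "t \<in> S" using \<open>\<not> B t \<le> C t\<close> by (simp add: S_def)
  have S_pos: "0 < s" if "s \<in> S" for s
    using that admissible_0[OF B(1), of s] admissible_0[OF C(1), of s] by (force simp: S_def)
  then have bdd: "bdd_below S" by (intro bdd_belowI[of _ 0]) (auto intro: less_imp_le)
  define t0 where "t0 = Inf S"
  have before: "B s \<le> C s" if "s < t0" for s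
    using cInf_lower[OF _ bdd, of s] that by (force simp: t0_def S_def)
  obtain \<delta> where \<delta>: "\<delta> > 0" "primitive h \<delta> < 1" using ex_small_window by blast
  define c where "c = (SUP s\<in>{..t0 + \<delta>}. max 0 (B s - C s))"
  have bddc: "bdd_above ((\<lambda>s. max 0 (B s - C s)) ` {..t0 + \<delta>})"
  proof (rule bdd_aboveI2)
    fix s
    show "max 0 (B s - C s) \<le> integral\<^sup>L lborel l"
      using admissible_le[OF B(1), of s] admissible_nonneg[OF C(1), of s] primitive_l_nonneg[of s]
        primitive_l_le[of s] by auto
  qed
  have c_upper: "max 0 (B s - C s) \<le> c" if "s \<le> t0 + \<delta>" for s
    unfolding c_def by (rule cSUP_upper[OF _ bddc]) (use that in auto)
  have c_nonneg: "0 \<le> c" using c_upper[of t0] \<delta> by auto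
  \<comment> \<open>Delays \<open>r > \<delta>\<close> reach back before \<open>t0\<close>, where
    \<open>B - C\<close> is nonpositive. Delays between 0 and \<open>\<delta>\<close> meet a gap of
    at most \<open>c\<close>, so only the mass of \<open>h\<close> up to \<open>\<delta>\<close>
    counts.\<close>
  have excess: "excess B s \<le> excess C s + c * primitive h \<delta>" if "s \<le> t0 + \<delta>" for s
  proof -
    have "excess B s - excess C s = (\<integral>r. (B (s - r) - C (s - r)) * h r \<partial>lborel)"
      by (rule excess_diff[OF B(1) C(1)])
    also have "\<dots> \<le> (\<integral>r. c * (h r * indicator {..\<delta>} r) \<partial>lborel)"
    proof (rule integral_mono)
      fix r
      show "(B (s - r) - C (s - r)) * h r \<le> c * (h r * indicator {..\<delta>} r)"
      proof (cases "r \<le> \<delta>")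
        case True
        show ?thesis
        proof (cases "r < 0")
          case False
          then have "B (s - r) - C (s - r) \<le> c" using c_upper[of "s - r"] that by auto
          then show ?thesis using True h_nonneg[of r] by (auto intro: mult_right_mono)
        qed (simp add: h_neg)
      next
        case False
        then have "B (s - r) \<le> C (s - r)" using before[of "s - r"] that by auto
        then show ?thesis using False h_nonneg[of r] by (simp add: mult_nonpos_nonneg)
      qed
    qed (use integrable_excess_diff[OF B(1) C(1)] integrable_times_atMost[OF integrable_h] in auto)
    also have "\<dots> = c * primitive h \<delta>" by (simp add: primitive_def)
    finally show ?thesis by simp
  qed
  have h\<delta>: "0 \<le> primitive h \<delta>" by (rule primitive_nonneg[OF h_nonneg])
  have "B s - C s \<le> c * primitive h \<delta>" if "s \<le> t0 + \<delta>" for s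
    using regulator_le_add[OF B(1) C(1), of "c * primitive h \<delta>" s] excess that c_nonneg h\<delta> B(2) C(2)
    by (simp add: algebra_simps)
  then have "c \<le> c * primitive h \<delta>"
    unfolding c_def by (intro cSUP_least) (use c_nonneg h\<delta> in \<open>auto simp flip: c_def\<close>)
  \<comment> \<open>A factor below 1 leaves only \<open>c = 0\<close>, which moves every point of
    \<open>S\<close> beyond \<open>t0 + \<delta>\<close>.\<close>
  then have "c * (1 - primitive h \<delta>) \<le> 0" by (simp add: algebra_simps)
  with \<delta> c_nonneg have "c = 0" by (simp add: mult_le_0_iff)
  then have "B s \<le> C s" if "s \<le> t0 + \<delta>" for s
    using c_upper[OF that] by auto
  then have "t0 + \<delta> \<le> s" if "s \<in> S" for s
    using that unfolding S_def by (metis linorder_not_less mem_Collect_eq nle_le)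
  then have "t0 + \<delta> \<le> t0"
    using cInf_greatest[of S "t0 + \<delta>"] \<open>t \<in> S\<close> by (auto simp: t0_def)
  with \<delta> show False by simp
qed

lemma regulator_fixpoint_unique:
  assumes "admissible B" "regulator B = B" "admissible C" "regulator C = C"
  shows "B = C"
  by (rule ext, rule antisym; rule regulator_fixpoint_le) (fact assms)+

section \<open>The Skorokhod problem\<close>

text \<open>The scaled number in system when arrivals are accepted at rate \<open>a\<close>; the
  convolution counts the departures among the accepted.\<close>

definition state :: "(real \<Rightarrow> real) \<Rightarrow> real \<Rightarrow> real" where
  "state a t = p t + primitive a t - convolve (primitive a) h t"

lemma state_eq_excess:
  "state a t = 1 + excess (\<lambda>s. primitive l s - primitive a s) t - (primitive l t - primitive a t)"
  by (simp add: state_def excess_def)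

lemma admissible_deficit:
  assumes a: "a \<in> borel_measurable borel" "\<And>u. 0 \<le> a u" "\<And>u. a u \<le> l u"
  shows "integrable lborel a" and "admissible (\<lambda>t. primitive l t - primitive a t)"
proof -
  show int: "integrable lborel a"
    using integrable_l by (rule Bochner_Integration.integrable_bound)
      (use a l_nonneg in auto)
  have a0: "primitive a t = 0" if "t \<le> 0" for t
    using primitive_eq_0[of a, OF _ that] a(2,3) l_neg by (metis antisym)
  have "mono (\<lambda>t. primitive l t - primitive a t)"
  proof (rule monoI)
    fix s t :: real assume "s \<le> t"
    have "primitive a t - primitive a s \<le> primitive l t - primitive l s"
      unfolding primitive_diff[OF int \<open>s \<le> t\<close>] primitive_diff[OF integrable_l \<open>s \<le> t\<close>]
    proof (rule integral_mono)
      show "integrable lborel (\<lambda>u. a u * indicator {s<..t} u)"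
        using int by (rule Bochner_Integration.integrable_bound) (use a in \<open>auto simp: indicator_def\<close>)
      show "integrable lborel (\<lambda>u. l u * indicator {s<..t} u)"
        using integrable_l by (rule Bochner_Integration.integrable_bound)
          (use borel_measurable_integrable[OF integrable_l] in \<open>auto simp: indicator_def\<close>)
    qed (use a in \<open>auto simp: indicator_def\<close>)
    then show "primitive l s - primitive a s \<le> primitive l t - primitive a t" by simp
  qed
  then show "admissible (\<lambda>t. primitive l t - primitive a t)"
    unfolding admissible_def using a0 primitive_l_0 mono_primitive[OF int a(2)]
    by (auto simp: fun_eq_iff)
qed

text \<open>This is the uniqueness half of the Skorokhod problem: the deficit can only grow while it
  equals the running maximum of the excess.\<close>

lemma regulator_deficit:
  assumes a: "a \<in> borel_measurable borel" "\<And>u. 0 \<le> a u" "\<And>u. a u \<le> l u"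
    and le1: "\<And>t. state a t \<le> 1"
    and full: "AE t in lborel. state a t < 1 \<longrightarrow> a t = l t"
  shows "regulator (\<lambda>t. primitive l t - primitive a t) = (\<lambda>t. primitive l t - primitive a t)"
proof
  fix t
  note int = admissible_deficit(1)[OF a]
  define B where "B t = primitive l t - primitive a t" for t
  have B: "admissible B" unfolding B_def by (rule admissible_deficit(2)[OF a])
  have st: "state a s = 1 + excess B s - B s" for s
    unfolding state_eq_excess B_def ..
  have "regulator B t \<le> B t"
  proof (rule regulator_least[OF B admissible_nonneg[OF B]])
    fix s assume "s \<le> t"
    with le1[of s] st[of s] admissible_mono[OF B, of s t] show "excess B s \<le> B t" by simp
  qed
  moreover have "B t \<le> regulator B t"
  proof (rule ccontr)
    assume "\<not> B t \<le> regulator B t"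
    then have Bt: "regulator B t < B t" by simp
    have "0 < t"
      using Bt regulator_nonneg[OF B, of t] admissible_0[OF B, of t] by force
    \<comment> \<open>The supremum of \<open>S\<close> is the last time up to \<open>t\<close> at
      which \<open>B\<close> has not yet passed \<open>regulator B t\<close>. It belongs to
      \<open>S\<close> because \<open>B\<close> is continuous.\<close>
    define S where "S = {s. s \<le> t \<and> B s \<le> regulator B t}"
    have "closed S"
      unfolding S_def
      by (intro closed_Collect_conj closed_Collect_le continuous_intros continuous_on_admissible[OF B])
    moreover have "0 \<in> S"
      using \<open>0 < t\<close> admissible_0[OF B, of 0] regulator_nonneg[OF B] by (simp add: S_def)
    moreover have bdd: "bdd_above S" by (rule bdd_aboveI[of _ t]) (simp add: S_def)
    ultimately have "Sup S \<in> S" by (intro closed_contains_Sup) auto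
    define s where "s = Sup S"
    have s: "s \<le> t" "B s \<le> regulator B t"
      using \<open>Sup S \<in> S\<close> by (auto simp: S_def s_def)
    \<comment> \<open>After \<open>s\<close> the deficit lies above the running maximum, so the
      system is not full and all arrivals are accepted. Hence \<open>B\<close> cannot grow from
      \<open>s\<close> to \<open>t\<close>, contrary to the assumed gap.\<close>
    have below: "state a u < 1" if "s < u" "u \<le> t" for u
    proof -
      have "u \<notin> S" using cSup_upper[OF _ bdd, of u] that by (auto simp: s_def)
      then have "regulator B t < B u" using that by (auto simp: S_def)
      with regulator_upper[OF B \<open>u \<le> t\<close>] st[of u] show ?thesis by simp
    qed
    have "primitive a t - primitive a s = primitive l t - primitive l s"
      by (rule primitive_ae_eq[OF int integrable_l s(1)])
         (use full below in \<open>auto elim!: eventually_mono\<close>)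
    then have "B t = B s" by (simp add: B_def)
    with s Bt show False by simp
  qed
  ultimately show "regulator (\<lambda>t. primitive l t - primitive a t) t = primitive l t - primitive a t"
    unfolding B_def[abs_def] by (rule antisym)
qed

section \<open>Recovery of the control from a fixed point\<close>

lemma interval_measure_level_null:
  assumes B: "admissible B"
  shows "AE x in interval_measure B. \<not> (0 \<le> x \<and> x \<le> q \<and> B x = B q)"
proof (rule AE_I')
  let ?S = "{x. 0 \<le> x \<and> x \<le> q \<and> B x = B q}"
  show "?S \<in> null_sets (interval_measure B)"
  proof (cases "?S = {}")
    case False
    have "closed ?S"
      by (intro closed_Collect_conj closed_Collect_le closed_Collect_eq continuous_intros
          continuous_on_admissible[OF B])
    moreover have bdd: "bdd_below ?S" by (rule bdd_belowI[of _ 0]) simp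
    ultimately have Inf: "Inf ?S \<in> ?S" using False by (intro closed_contains_Inf)
    define a where "a = Inf ?S"
    have a: "0 \<le> a" "a \<le> q" "B a = B q" using Inf by (auto simp: a_def)
    \<comment> \<open>A monotone function is constant between two points of equal value, so the
      level set is an interval and its mass is the increment \<open>B q - B a\<close>, which is
      0.\<close>
    have "?S = {a..q}"
    proof (intro set_eqI iffI)
      fix x assume "x \<in> ?S"
      then show "x \<in> {a..q}" using cInf_lower[OF _ bdd] by (auto simp: a_def)
    next
      fix x assume "x \<in> {a..q}"
      then show "x \<in> ?S"
        using a admissible_mono[OF B, of a x] admissible_mono[OF B, of x q] by auto
    qed
    moreover have "emeasure (interval_measure B) {a..q} = B q - B a"
      by (rule emeasure_interval_measure_Icc[OF a(2) admissible_mono[OF B] continuous_on_admissible[OF B]])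
    ultimately show ?thesis using a by (simp add: null_sets_def)
  next
    case True
    show ?thesis unfolding True by simp
  qed
qed auto

lemma right_cont_state:
  assumes "integrable lborel a" "\<And>u. 0 \<le> a u"
  shows "continuous (at_right t) (state a)"
  unfolding state_def
proof (intro continuous_intros p_right_cont)
  have abs: "\<bar>primitive a x\<bar> \<le> integral\<^sup>L lborel a" for x
    using primitive_nonneg[of a x] primitive_le_integral[of a x] assms by simp
  show "continuous (at_right t) (primitive a)"
    by (rule continuous_at_imp_continuous_at_within, rule isCont_primitive) fact
  show "continuous (at_right t) (convolve (primitive a) h)"
    by (rule continuous_at_imp_continuous_at_within, rule isCont_convolve)
       (rule isCont_primitive abs integrable_h assms)+
qed

text \<open>The control is the density of the accepted arrivals \<open>primitive l - B\<close> with
  respect to \<open>l\<close>. Just after a time with state below 1 the running maximum is flat, so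
  the Stieltjes measure of \<open>B\<close> does not charge such times; its density vanishes there
  and that of the accepted arrivals is 1.\<close>

lemma fixpoint_control:
  assumes B: "admissible B" and fixed: "regulator B = B"
  obtains z where "z \<in> borel_measurable borel" "\<And>u. 0 \<le> z u" "\<And>u. z u \<le> 1"
    "\<And>t. primitive (\<lambda>u. z u * l u) t = primitive l t - B t"
    "AE t in lborel. state (\<lambda>u. z u * l u) t < 1 \<longrightarrow> z t = 1"
proof -
  note [measurable] = borel_measurable_integrable[OF integrable_l]
  define A where "A t = primitive l t - B t" for t
  have "mono A" using B unfolding admissible_def A_def by simp
  have "mono B" using B by (simp add: admissible_def)
  have contA: "isCont A t" for t unfolding A_def by (rule isCont_primitive_diff[OF B])
  obtain f g where fg [measurable]: "f \<in> borel_measurable borel" "g \<in> borel_measurable borel"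
    and f: "density (density lborel l) f = interval_measure A"
    and g: "density (density lborel l) g = interval_measure B"
    and sum: "AE u in density lborel l. f u + g u = (1 :: ennreal)"
    using interval_measure_densities[OF integrable_l l_nonneg \<open>mono A\<close> contA \<open>mono B\<close> isCont_admissible[OF B]]
    by (auto simp: A_def)
  \<comment> \<open>Where \<open>l\<close> vanishes the density is arbitrary, and 1 is the value
    demanded below capacity. The cap makes the bounds hold at every point and not only almost
    everywhere.\<close>
  define z where "z u = (if l u = 0 then 1 else min 1 (enn2real (f u)))" for u
  have [measurable]: "z \<in> borel_measurable borel" unfolding z_def by measurable
  have z: "0 \<le> z u" "z u \<le> 1" for u by (auto simp: z_def)
  have sum': "AE u in lborel. 0 < l u \<longrightarrow> f u + g u = 1"
    using sum by (subst (asm) AE_density) auto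
  have zf: "AE u in lborel. ennreal (z u * l u) = l u * f u"
    using sum'
  proof eventually_elim
    case (elim u)
    show ?case
    proof (cases "l u = 0")
      case False
      then have "f u + g u = 1" using elim l_nonneg[of u] by auto
      then have "f u \<le> 1" by (metis le_iff_add)
      then have "enn2real (f u) \<le> 1" "f u \<noteq> \<infinity>"
        by (auto simp: enn2real_leI top_unique)
      with False show ?thesis
        using l_nonneg[of u] by (simp add: z_def ennreal_mult mult.commute ennreal_enn2real_if)
    qed (simp add: z_def)
  qed
  define a where "a u = z u * l u" for u
  have [measurable]: "a \<in> borel_measurable borel" unfolding a_def by measurable
  have a: "0 \<le> a u" "a u \<le> l u" for u
    using z l_nonneg by (auto simp: a_def mult_left_le_one_le)
  note int = admissible_deficit(1)[OF _ a]
  have prim: "primitive a t = A t" for t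
  proof -
    have neg: "primitive a t = 0" "A t = 0" if "t \<le> 0" for t
      using primitive_eq_0[of a t] that l_neg admissible_0[OF B that] primitive_l_0[OF that]
      by (auto simp: A_def a_def)
    show ?thesis
    proof (cases "0 \<le> t")
      case True
      have "ennreal (A t - A 0) = emeasure (interval_measure A) {0<..t}"
        using \<open>mono A\<close> contA True
        by (subst emeasure_interval_measure_Ioc)
           (auto simp: mono_def intro: continuous_at_imp_continuous_at_within)
      also have "\<dots> = (\<integral>\<^sup>+u. l u * f u * indicator {0<..t} u \<partial>lborel)"
        by (simp add: f[symmetric] density_density_eq emeasure_density)
      also have "\<dots> = (\<integral>\<^sup>+u. ennreal (a u) * indicator {0<..t} u \<partial>lborel)"
        using zf by (intro nn_integral_cong_AE) (auto simp: a_def)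
      also have "\<dots> = emeasure (density lborel a) {0<..t}"
        by (simp add: emeasure_density)
      also have "\<dots> = ennreal (primitive a t - primitive a 0)"
        by (rule emeasure_density_primitive[OF int a(1) True]) simp
      finally show ?thesis
        using neg[of 0] monoD[OF \<open>mono A\<close> True] monoD[OF mono_primitive[OF int a(1)] True] by simp
    qed (use neg in simp)
  qed
  have st: "state a t = 1 + excess B t - B t" for t
    by (simp add: state_eq_excess prim) (simp add: A_def)
  \<comment> \<open>State below 1 means \<open>excess B t < B t\<close>. Right continuity keeps the
    excess below \<open>B t\<close> for a while, so the running maximum does not move until some
    rational \<open>q\<close>.\<close>
  have low: "\<exists>q\<in>\<rat>. t < q \<and> B t = B q" if "state a t < 1" for t
  proof -
    have "isCont B t" by (rule isCont_admissible[OF B])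
    have "((state a) \<longlongrightarrow> state a t) (at_right t)"
      using right_cont_state[OF int a(1), of t] by (simp add: continuous_within)
    then have "((\<lambda>u. state a u - 1 + B u) \<longlongrightarrow> state a t - 1 + B t) (at_right t)"
      using continuous_at_imp_continuous_at_within[OF \<open>isCont B t\<close>, of "{t<..}"]
      by (intro tendsto_intros) (auto simp: continuous_within)
    then have "((\<lambda>u. excess B u) \<longlongrightarrow> excess B t) (at_right t)"
      by (simp add: st)
    moreover have "excess B t < B t" using that by (simp add: st)
    ultimately have "\<forall>\<^sub>F u in at_right t. excess B u < B t" by (rule order_tendstoD(2))
    then obtain b where b: "t < b" "\<And>u. t < u \<Longrightarrow> u < b \<Longrightarrow> excess B u < B t"
      by (auto simp: eventually_at_right_field)
    obtain q where q: "q \<in> \<rat>" "t < q" "q < b" using Rats_dense_in_real[OF b(1)] by blast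
    have "regulator B q \<le> B t"
    proof (rule regulator_least[OF B admissible_nonneg[OF B]])
      fix u assume "u \<le> q"
      show "excess B u \<le> B t"
        using regulator_upper[OF B, of u t] b(2)[of u] \<open>u \<le> q\<close> q fixed by (cases "u \<le> t") auto
    qed
    then have "B t = B q" using fixed admissible_mono[OF B, of t q] q by simp
    with q show ?thesis by blast
  qed
  \<comment> \<open>Rational right endpoints make the exceptional set a countable union of null
    level sets.\<close>
  have "AE x in interval_measure B. \<forall>q\<in>\<rat>. \<not> (0 \<le> x \<and> x \<le> q \<and> B x = B q)"
    using interval_measure_level_null[OF B] by (intro AE_ball_countable' countable_rat) auto
  then have "AE x in interval_measure B. 0 \<le> x \<longrightarrow> \<not> state a x < 1"
    by eventually_elim (use low in \<open>meson less_imp_le\<close>)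
  then have "AE x in lborel. 0 < l x * g x \<longrightarrow> 0 \<le> x \<longrightarrow> \<not> state a x < 1"
    unfolding g[symmetric] by (subst (asm) density_density_eq) (auto simp: AE_density)
  with sum' have "AE x in lborel. state a x < 1 \<longrightarrow> z x = 1"
  proof eventually_elim
    case (elim x)
    show ?case
    proof
      assume st: "state a x < 1"
      show "z x = 1"
      proof (cases "l x = 0")
        case False
        then have "0 < l x" "0 \<le> x" using l_nonneg[of x] l_neg[of x] by force+
        with elim st have "\<not> 0 < l x * g x" "f x + g x = 1" by auto
        with \<open>0 < l x\<close> have "f x = 1"
          by (metis add.right_neutral ennreal_eq_0_iff linorder_not_less mult_eq_0_iff zero_less_iff_neq_zero)
        then show ?thesis by (simp add: z_def)
      qed (simp add: z_def)
    qed
  qed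
  then show ?thesis
    using z prim by (intro that[of z]) (auto simp: a_def[abs_def] A_def)
qed

end

section \<open>The loss equation\<close>

text \<open>Ties \<open>l\<close>, \<open>h\<close> and \<open>p\<close> to the data on
  \<open>{0..T}\<close>. Switching arrivals off after \<open>T\<close> lets the Skorokhod problem be
  posed on the whole line.\<close>

locale loss_equation = reflected_volterra +
  fixes T \<rho>\<^sub>0 :: real and lam G F :: "real \<Rightarrow> real"
  assumes T_pos: "0 < T"
    and l_beyond: "T < t \<Longrightarrow> l t = 0"
    and lam_measurable: "set_borel_measurable lebesgue {0..T} lam"
    and lam_eq: "AE u in lborel. u \<in> {0..T} \<longrightarrow> lam u = l u"
    and G_eq: "t \<in> {0..T} \<Longrightarrow> G t = primitive h t"
    and p_eq: "t \<in> {0..T} \<Longrightarrow> p t = \<rho>\<^sub>0 * (1 - F t)"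
    and p_nonneg: "0 \<le> p t"
    and primitive_h_le_1: "t \<in> {0..T} \<Longrightarrow> primitive h t \<le> 1"
begin

text \<open>Subtracting the Fubini form of the convolution from \<open>primitive a\<close> leaves
  the kernel \<open>1 - primitive h (t - u)\<close>, which is \<open>1 - G (t - u)\<close> on
  \<open>{0..t}\<close>. The sign follows as this kernel is nonnegative.\<close>

lemma volterra_integral_eq:
  assumes z: "z \<in> borel_measurable (lebesgue_on {0..T})"
    and z' [measurable]: "z' \<in> borel_measurable borel" and bounds: "\<And>u. 0 \<le> z' u" "\<And>u. z' u \<le> 1"
    and eq: "AE u in lborel. u \<in> {0..T} \<longrightarrow> z u = z' u"
    and t: "t \<in> {0..T}"
  defines "a \<equiv> \<lambda>u. z' u * l u"
  shows "(LINT u:{0..t}|lebesgue. z u * (1 - G (t - u)) * lam u) =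
      primitive a t - convolve (primitive a) h t" (is "?L = ?R")
    and "0 \<le> (LINT u:{0..t}|lebesgue. z u * (1 - G (t - u)) * lam u)"
proof -
  note [measurable] = borel_measurable_integrable[OF integrable_l] borel_measurable_integrable[OF integrable_h]
  have ab [measurable]: "a \<in> borel_measurable borel" and a: "0 \<le> a u" "a u \<le> l u" for u
    using bounds l_nonneg unfolding a_def by (auto simp: mult_left_le_one_le)
  note int = admissible_deficit(1)[OF ab a]
  have H [measurable]: "primitive h \<in> borel_measurable borel"
    by (rule borel_measurable_mono[OF mono_primitive[OF integrable_h h_nonneg]])
  have H0: "primitive h s = 0" if "s \<le> 0" for s
    using primitive_eq_0[OF h_neg that] .
  have intH: "integrable lborel (\<lambda>u. primitive h (t - u) * a u)"
  proof (rule integrable_bounded_times[OF _ _ int])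
    show "\<bar>primitive h (t - u)\<bar> \<le> integral\<^sup>L lborel h" for u
      using primitive_nonneg[of h "t - u"] primitive_le_integral[OF integrable_h h_nonneg] h_nonneg by simp
  qed measurable
  define k where "k u = a u * indicator {0..t} u * (1 - primitive h (t - u))" for u
  have [measurable]: "k \<in> borel_measurable lborel" unfolding k_def by measurable
  have "primitive a t - convolve (primitive a) h t =
      (\<integral>u. a u * indicator {..t} u - primitive h (t - u) * a u \<partial>lborel)"
    unfolding convolve_primitive[OF int integrable_h] unfolding primitive_def[of a]
    using Bochner_Integration.integral_diff[OF integrable_times_atMost[OF int, of t] intH]
    by (simp add: mult.commute)
  also have "\<dots> = integral\<^sup>L lborel k"
  proof (rule Bochner_Integration.integral_cong[OF refl])
    fix u
    \<comment> \<open>Below 0 the rate \<open>a\<close> vanishes, and beyond \<open>t\<close> so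
      does \<open>primitive h (t - u)\<close>.\<close>
    show "a u * indicator {..t} u - primitive h (t - u) * a u = k u"
      using H0[of "t - u"] l_neg[of u]
      by (cases "u < 0"; cases "u \<le> t") (auto simp: k_def a_def indicator_def algebra_simps)
  qed
  finally have R: "?R = integral\<^sup>L lborel k" .
  have "integral\<^sup>L lborel k = integral\<^sup>L lebesgue k" by (simp add: integral_completion)
  also have "\<dots> = ?L"
    unfolding set_lebesgue_integral_def
  proof (rule integral_cong_AE)
    show "k \<in> borel_measurable lebesgue" by (intro measurable_completion) measurable
    have zm: "(\<lambda>u. indicator {0..T} u *\<^sub>R z u) \<in> borel_measurable lebesgue"
      using z by (subst (asm) borel_measurable_restrict_space_iff) auto
    have lm: "(\<lambda>u. indicator {0..T} u *\<^sub>R lam u) \<in> borel_measurable lebesgue"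
      using lam_measurable by (simp add: set_borel_measurable_def)
    have im: "(\<lambda>u. indicator {0..t} u * (1 - primitive h (t - u))) \<in> borel_measurable lebesgue"
      by (intro measurable_completion) measurable
    \<comment> \<open>Since \<open>G\<close> is known only on \<open>{0..T}\<close>, measurability
      of the integrand is derived from a product with \<open>primitive h\<close> in its
      place.\<close>
    have "(\<lambda>u. (indicator {0..T} u *\<^sub>R z u) * ((indicator {0..t} u * (1 - primitive h (t - u))) *
        (indicator {0..T} u *\<^sub>R lam u))) \<in> borel_measurable lebesgue"
      by (rule borel_measurable_times[OF zm borel_measurable_times[OF im lm]])
    also have "(\<lambda>u. (indicator {0..T} u *\<^sub>R z u) * ((indicator {0..t} u * (1 - primitive h (t - u))) *
        (indicator {0..T} u *\<^sub>R lam u))) =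
        (\<lambda>u. indicator {0..t} u *\<^sub>R (z u * (1 - G (t - u)) * lam u))"
      using t G_eq by (auto simp: indicator_def fun_eq_iff)
    finally show "(\<lambda>u. indicator {0..t} u *\<^sub>R (z u * (1 - G (t - u)) * lam u)) \<in> borel_measurable lebesgue" .
    have "AE u in lborel. k u = indicator {0..t} u *\<^sub>R (z u * (1 - G (t - u)) * lam u)"
      using eq lam_eq
      by eventually_elim (use t G_eq in \<open>auto simp: k_def a_def indicator_def\<close>)
    then show "AE u in lebesgue. k u = indicator {0..t} u *\<^sub>R (z u * (1 - G (t - u)) * lam u)"
      by (rule AE_completion)
  qed
  finally have L: "?L = integral\<^sup>L lborel k" ..
  with R show "?L = ?R" by simp
  have "0 \<le> integral\<^sup>L lborel k"
  proof (rule Bochner_Integration.integral_nonneg)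
    fix u
    show "0 \<le> k u"
      using a primitive_h_le_1[of "t - u"] t by (auto simp: k_def indicator_def)
  qed
  with L show "0 \<le> ?L" by simp
qed

text \<open>With a Borel version of \<open>z\<close> the solution is the state for the rate
  \<open>a\<close>, and the constraints on \<open>z\<close> become those of the Skorokhod problem,
  whose uniqueness half makes the deficit a fixed point.\<close>

lemma solution_is_state:
  assumes "loss_volterra_solution T lam G \<rho>\<^sub>0 F \<rho>"
  obtains a where "a \<in> borel_measurable borel" "\<And>u. 0 \<le> a u" "\<And>u. a u \<le> l u"
    "\<And>t. t \<in> {0..T} \<Longrightarrow> \<rho> t = state a t"
    "regulator (\<lambda>t. primitive l t - primitive a t) = (\<lambda>t. primitive l t - primitive a t)"
proof -
  note [measurable] = borel_measurable_integrable[OF integrable_l]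
  from assms obtain z where zm: "z \<in> borel_measurable (lebesgue_on {0..T})"
    and \<rho>: "\<And>t. t \<in> {0..T} \<Longrightarrow>
      \<rho> t = \<rho>\<^sub>0 * (1 - F t) + (LINT u:{0..t}|lebesgue. z u * (1 - G (t - u)) * lam u)"
    and \<rho>_le: "\<And>t. t \<in> {0..T} \<Longrightarrow> \<rho> t \<le> 1"
    and ae: "AE t in lebesgue_on {0..T}. indicat_real {s. \<rho> s < 1} t \<le> z t \<and> z t \<le> 1"
    unfolding loss_volterra_solution_def by blast
  have z: "AE t in lborel. t \<in> {0..T} \<longrightarrow> indicat_real {s. \<rho> s < 1} t \<le> z t \<and> z t \<le> 1"
    using ae by (subst (asm) AE_restrict_space_iff) (auto simp: AE_completion_iff)
  have "AE t in lborel. t \<in> {0..T} \<longrightarrow> 0 \<le> z t \<and> z t \<le> 1"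
    using z by eventually_elim (auto intro: order_trans[OF indicator_pos_le])
  then obtain z' where z'm [measurable]: "z' \<in> borel_measurable borel"
    and z': "\<And>u. 0 \<le> z' u" "\<And>u. z' u \<le> 1" and eq: "AE u in lborel. u \<in> {0..T} \<longrightarrow> z u = z' u"
    using ex_borel_version_unit[OF zm] by blast
  define a where "a u = z' u * l u" for u
  have ab [measurable]: "a \<in> borel_measurable borel" and a: "0 \<le> a u" "a u \<le> l u" for u
    using z' l_nonneg unfolding a_def by (auto simp: mult_left_le_one_le)
  note int = admissible_deficit(1)[OF ab a] and adm = admissible_deficit(2)[OF ab a]
  have st: "\<rho> t = state a t" if "t \<in> {0..T}" for t
    using \<rho>[OF that] volterra_integral_eq(1)[OF zm z'm z' eq that] p_eq[OF that]
    by (simp add: state_def a_def[abs_def])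
  have conv_nonneg: "0 \<le> convolve (primitive a) h t" for t
    using convolve_diff_nonneg[OF adm] by simp
  have conv_mono: "convolve (primitive a) h s \<le> convolve (primitive a) h t" if "s \<le> t" for s t
    using convolve_diff_mono[OF adm that] by simp
  \<comment> \<open>The bound has to hold at all real times. Before 0 nothing has arrived; after
    \<open>T\<close> arrivals have stopped while departures go on, so the state cannot rise.\<close>
  have le1: "state a t \<le> 1" for t
  proof -
    consider "t < 0" | "t \<in> {0..T}" | "T < t" by fastforce
    then show ?thesis
    proof cases
      case 1
      then have "primitive a t = 0"
        by (intro primitive_eq_0) (auto simp: a_def l_neg)
      then show ?thesis using conv_nonneg[of t] p_le_1[of t] by (simp add: state_def)
    next
      case 2
      then show ?thesis using st \<rho>_le by simp
    next
      case 3
      have "primitive a t - primitive a T = (\<integral>u. a u * indicator {T<..t} u \<partial>lborel)"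
        using 3 by (intro primitive_diff int) simp
      also have "(\<lambda>u. a u * indicator {T<..t} u) = (\<lambda>_. 0)"
        by (auto simp: a_def l_beyond indicator_def fun_eq_iff)
      finally have "primitive a t = primitive a T" by simp
      then have "state a t \<le> state a T"
        using 3 conv_mono[of T t] antimonoD[OF antimono_p, of T t] by (simp add: state_def)
      then show ?thesis using st[of T] \<rho>_le[of T] T_pos by simp
    qed
  qed
  have "AE t in lborel. state a t < 1 \<longrightarrow> a t = l t"
    using z eq
  proof eventually_elim
    case (elim t)
    show ?case
    proof (cases "t \<in> {0..T}")
      case True
      then show ?thesis using elim st[OF True] by (auto simp: a_def)
    next
      case False
      then have "l t = 0" using l_neg[of t] l_beyond[of t] by force
      then show ?thesis by (simp add: a_def)
    qed
  qed
  from regulator_deficit[OF ab a le1 this] ab a st that show ?thesis by blast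
qed

text \<open>Both deficits are the one fixed point, and the state depends on the rate only through
  its primitive. The controls themselves may differ where \<open>l\<close> vanishes.\<close>

lemma solution_unique:
  assumes "loss_volterra_solution T lam G \<rho>\<^sub>0 F \<rho>" "loss_volterra_solution T lam G \<rho>\<^sub>0 F \<rho>'"
    and t: "t \<in> {0..T}"
  shows "\<rho> t = \<rho>' t"
proof -
  obtain a where a: "a \<in> borel_measurable borel" "\<And>u. 0 \<le> a u" "\<And>u. a u \<le> l u"
    "\<rho> t = state a t"
    "regulator (\<lambda>t. primitive l t - primitive a t) = (\<lambda>t. primitive l t - primitive a t)"
    using solution_is_state[OF assms(1)] t by metis
  obtain b where b: "b \<in> borel_measurable borel" "\<And>u. 0 \<le> b u" "\<And>u. b u \<le> l u"
    "\<rho>' t = state b t"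
    "regulator (\<lambda>t. primitive l t - primitive b t) = (\<lambda>t. primitive l t - primitive b t)"
    using solution_is_state[OF assms(2)] t by metis
  have "(\<lambda>t. primitive l t - primitive a t) = (\<lambda>t. primitive l t - primitive b t)"
    by (rule regulator_fixpoint_unique[OF admissible_deficit(2)[OF a(1-3)] a(5)
          admissible_deficit(2)[OF b(1-3)] b(5)])
  then have "primitive a = primitive b" by (simp add: fun_eq_iff)
  then show ?thesis using a(4) b(4) by (simp add: state_def)
qed

lemma ex_solution: "\<exists>\<rho>. loss_volterra_solution T lam G \<rho>\<^sub>0 F \<rho> \<and> \<rho> \<in> extensional {0..T}"
proof -
  obtain B where B: "admissible B" "regulator B = B" using ex_regulator_fixpoint by blast
  obtain z where zm [measurable]: "z \<in> borel_measurable borel" and z: "\<And>u. 0 \<le> z u" "\<And>u. z u \<le> 1"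
    and prim: "\<And>t. primitive (\<lambda>u. z u * l u) t = primitive l t - B t"
    and full: "AE t in lborel. state (\<lambda>u. z u * l u) t < 1 \<longrightarrow> z t = 1"
    using fixpoint_control[OF B] by blast
  define a where "a u = z u * l u" for u
  have st: "state a t = 1 + excess B t - B t" for t
    using prim by (simp add: state_eq_excess a_def[abs_def])
  define \<rho> where "\<rho> = restrict (state a) {0..T}"
  have zl: "z \<in> borel_measurable (lebesgue_on {0..T})"
    by (intro measurable_restrict_space1 measurable_completion) measurable
  have "loss_volterra_solution T lam G \<rho>\<^sub>0 F \<rho>"
    unfolding loss_volterra_solution_def
  proof (intro bexI[OF _ zl] conjI ballI)
    fix t assume t: "t \<in> {0..T}"
    note eq = volterra_integral_eq[OF zl zm z _ t]
    show sol: "\<rho> t = \<rho>\<^sub>0 * (1 - F t) + (LINT u:{0..t}|lebesgue. z u * (1 - G (t - u)) * lam u)"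
      using eq(1) p_eq[OF t] t by (simp add: \<rho>_def state_def a_def[abs_def])
    show "0 \<le> \<rho> t"
      unfolding sol using eq(2) p_nonneg[of t] p_eq[OF t] by simp
    \<comment> \<open>A fixed point dominates its own excess, which is the upper bound on the
      state.\<close>
    have "excess B t \<le> B t" using regulator_upper[OF B(1), of t t] B(2) by simp
    then show "\<rho> t \<le> 1" using t by (simp add: \<rho>_def st)
  next
    have "AE t in lborel. t \<in> {0..T} \<longrightarrow> indicat_real {s. \<rho> s < 1} t \<le> z t \<and> z t \<le> 1"
      using full by eventually_elim (use z in \<open>auto simp: \<rho>_def a_def[abs_def] indicator_def\<close>)
    then show "AE t in lebesgue_on {0..T}. indicat_real {s. \<rho> s < 1} t \<le> z t \<and> z t \<le> 1"
      by (subst AE_restrict_space_iff) (auto simp: AE_completion_iff)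
  qed
  then show ?thesis by (intro exI[of _ \<rho>]) (simp add: \<rho>_def)
qed

text \<open>Fixing the value off \<open>{0..T}\<close> by \<open>extensional\<close> turns equality
  on the interval into equality of functions.\<close>

lemma ex1_solution: "\<exists>!\<rho>. \<rho> \<in> extensional {0..T} \<and> loss_volterra_solution T lam G \<rho>\<^sub>0 F \<rho>"
proof (rule ex_ex1I)
  show "\<exists>\<rho>. \<rho> \<in> extensional {0..T} \<and> loss_volterra_solution T lam G \<rho>\<^sub>0 F \<rho>"
    using ex_solution by blast
  fix \<rho> \<rho>'
  assume "\<rho> \<in> extensional {0..T} \<and> loss_volterra_solution T lam G \<rho>\<^sub>0 F \<rho>"
    and "\<rho>' \<in> extensional {0..T} \<and> loss_volterra_solution T lam G \<rho>\<^sub>0 F \<rho>'"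
  then show "\<rho> = \<rho>'"
    using solution_unique by (intro extensionalityI[of \<rho> "{0..T}" \<rho>']) auto
qed

end

theorem theorem3p1:
  fixes T \<rho>\<^sub>0 :: real and lam G g F :: "real \<Rightarrow> real"
  assumes "T > 0"
    and "\<And>u. u \<ge> 0 \<Longrightarrow> lam u \<ge> 0"
    and "\<And>t. t \<ge> 0 \<Longrightarrow> set_integrable lebesgue {0..t} lam"
    and "nonneg_cdf G"
    and "nonneg_density G g"
    and "0 \<le> \<rho>\<^sub>0" and "\<rho>\<^sub>0 \<le> 1"
    and "nonneg_cdf F"
  shows "\<exists>!\<rho>. \<rho> \<in> extensional {0..T} \<and> loss_volterra_solution T lam G \<rho>\<^sub>0 F \<rho>"
proof -
  have lam_int: "set_integrable lebesgue {0..T} lam"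
    using assms(1,3) by simp
  have lam_nonneg: "0 \<le> lam x" if "x \<in> {0..T}" for x
    using assms(2) that by simp
  obtain l where l: "integrable lborel l" "\<And>x. 0 \<le> l x" "\<And>x. x \<notin> {0..T} \<Longrightarrow> l x = 0"
    "AE x in lborel. x \<in> {0..T} \<longrightarrow> lam x = l x"
    using ex_borel_version[OF lam_int lam_nonneg] by blast
  have g_int: "set_integrable lebesgue {0..t} g" and G: "G t = (LINT x:{0..t}|lebesgue. g x)"
    and g_nonneg: "0 \<le> g t" if "0 \<le> t" for t
    using assms(5) that by (auto simp: nonneg_density_def)
  have g_int_T: "set_integrable lebesgue {0..T} g"
    using g_int assms(1) by simp
  have g_nonneg_T: "0 \<le> g x" if "x \<in> {0..T}" for x
    using g_nonneg that by simp
  obtain h where h: "integrable lborel h" "\<And>x. 0 \<le> h x" "\<And>x. x \<notin> {0..T} \<Longrightarrow> h x = 0"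
    "AE x in lborel. x \<in> {0..T} \<longrightarrow> g x = h x"
    using ex_borel_version[OF g_int_T g_nonneg_T] by blast
  note [measurable] = borel_measurable_integrable[OF h(1)]
  obtain M where M: "real_distribution M" "\<And>t. 0 \<le> t \<Longrightarrow> F t = cdf M t"
    using assms(8) by (auto simp: nonneg_cdf_def)
  interpret M: real_distribution M by fact
  \<comment> \<open>Using the distribution function of \<open>M\<close> instead of \<open>F\<close>,
    whose values at negative arguments are arbitrary, gives monotonicity and right continuity on the
    whole line.\<close>
  define p where "p t = \<rho>\<^sub>0 * (1 - cdf M t)" for t
  have G_eq: "G t = primitive h t" if t: "t \<in> {0..T}" for t
  proof -
    have "G t = (\<integral>x. indicator {0..t} x *\<^sub>R g x \<partial>lebesgue)"
      using G t by (simp add: set_lebesgue_integral_def)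
    also have "\<dots> = (\<integral>x. h x * indicator {..t} x \<partial>lebesgue)"
    proof (rule integral_cong_AE)
      show "(\<lambda>x. indicator {0..t} x *\<^sub>R g x) \<in> borel_measurable lebesgue"
        using g_int[of t] t by (auto simp: set_integrable_def)
      show "(\<lambda>x. h x * indicator {..t} x) \<in> borel_measurable lebesgue"
        by (intro measurable_completion) measurable
      have "AE x in lborel. indicator {0..t} x *\<^sub>R g x = h x * indicator {..t} x"
        using h(4)
      proof eventually_elim
        case (elim x)
        then show ?case
          using h(3)[of x] t by (cases "x \<in> {0..T}") (auto simp: indicator_def)
      qed
      then show "AE x in lebesgue. indicator {0..t} x *\<^sub>R g x = h x * indicator {..t} x"
        by (rule AE_completion)
    qed
    also have "\<dots> = primitive h t"
      unfolding primitive_def by (rule integral_completion) measurable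
    finally show ?thesis .
  qed
  \<comment> \<open>The probability measure behind \<open>G\<close> supplies the bound
    \<open>primitive h t \<le> 1\<close> on \<open>{0..T}\<close>.\<close>
  obtain N where N: "real_distribution N" "\<And>t. 0 \<le> t \<Longrightarrow> G t = cdf N t"
    using assms(4) by (auto simp: nonneg_cdf_def)
  interpret loss_equation l h p T \<rho>\<^sub>0 lam G F
  proof
    show "antimono p"
      using assms(6) by (auto simp: p_def antimono_def intro!: mult_left_mono M.cdf_nondecreasing)
    show "p t \<le> 1" for t
      using mult_mono[of \<rho>\<^sub>0 1 "1 - cdf M t" 1] assms(6,7) M.cdf_bounded_prob[of t] M.cdf_nonneg[of t]
      by (simp add: p_def)
    show "0 \<le> p t" for t
      using assms(6) M.cdf_bounded_prob[of t] by (simp add: p_def)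
    show "continuous (at_right t) p" for t
      unfolding p_def by (intro continuous_intros M.cdf_is_right_cont)
    show "set_borel_measurable lebesgue {0..T} lam"
      using lam_int by (simp add: set_integrable_def set_borel_measurable_def borel_measurable_integrable)
    show "primitive h t \<le> 1" if "t \<in> {0..T}" for t
      using G_eq[OF that] N(2)[of t] that real_distribution.cdf_bounded_prob[OF N(1), of t] by simp
  qed (use assms(1) l h G_eq M(2) in \<open>auto simp: p_def\<close>)
  show ?thesis by (rule ex1_solution)
qed

end
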